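(* Let $1 \le u \le v$ be integers and let $(X_i,\kappa_i)$, $1\le i\le v$, be digital images. Then for every $i$ the projection map $$p_i: \Big(\prod_{j=1}^v X_j,\ NP_u(\kappa_1,\ldots,\kappa_v)\Big) \to (X_i,\kappa_i),\qquad p_i(x_1,\ldots,x_v)=x_i,$$ is continuous.
   Context: A digital image $(X,\kappa)$ is a set $X$ (of lattice points in some $\mathbb{Z}^n$) with an adjacency relation $\kappa$, i.e. a symmetric irreflexive binary relation on $X$. A function $f:(X,\kappa)\to(Y,\lambda)$ is continuous if it maps $\kappa$-connected subsets to $\lambda$-connected subsets; equivalently, if for all $\kappa$-adjacent $x,x'\in X$ the points $f(x),f(x')$ are equal or $\lambda$-adjacent. (A subset is connected if any two of its points are joined by a finite sequence within the subset whose consecutive terms are adjacent.) $NP_u(\kappa_1,\dots,\kappa_v)$-adjacency on $\prod_{i=1}^v X_i$, for $1\le u\le v$: $(x_1,\dots,x_v)$ and $(x_1',\dots,x_v')$ are adjacent iff for at least $1$ and at most $u$ indices $i$, $x_i$ and $x_i'$ are $\kappa_i$-adjacent, and for all other indices $i$, $x_i=x_i'$. *)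

theory Defs
  imports "HOL-Library.FuncSet"
begin

text \<open>
  A lattice point of dimension \<open>n\<close> is an integer list of length \<open>n\<close>, so that
  the factors of a product may live in lattices of different dimensions.
\<close>

definition digital_image :: "int list set \<Rightarrow> int list rel \<Rightarrow> bool" where
  "digital_image X \<kappa> \<longleftrightarrow>
     (\<exists>n. X \<subseteq> {x. length x = n}) \<and> \<kappa> \<subseteq> X \<times> X \<and> sym \<kappa> \<and> irrefl \<kappa>"

definition dig_connected :: "'a rel \<Rightarrow> 'a set \<Rightarrow> bool" where
  "dig_connected \<kappa> A \<longleftrightarrow>
     (\<forall>x\<in>A. \<forall>y\<in>A. \<exists>p. p \<noteq> [] \<and> hd p = x \<and> last p = y \<and> set p \<subseteq> A \<and>
        successively (\<lambda>a b. (a, b) \<in> \<kappa>) p)"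

definition dig_continuous ::
    "'a set \<Rightarrow> 'a rel \<Rightarrow> 'b set \<Rightarrow> 'b rel \<Rightarrow> ('a \<Rightarrow> 'b) \<Rightarrow> bool" where
  "dig_continuous X \<kappa> Y \<mu> f \<longleftrightarrow>
     f \<in> X \<rightarrow> Y \<and> (\<forall>A. A \<subseteq> X \<and> dig_connected \<kappa> A \<longrightarrow> dig_connected \<mu> (f ` A))"

text \<open>
  A tuple \<open>(x\<^sub>1, \<dots>, x\<^sub>v)\<close> is an extensional function on \<open>{1..v}\<close>; concatenating its components
  would turn it into a lattice point again.  The indices not counted by the cardinality are exactly
  those at which the components are not adjacent, and there they have to be equal.
\<close>

definition NP :: "nat \<Rightarrow> nat \<Rightarrow> (nat \<Rightarrow> 'a set) \<Rightarrow> (nat \<Rightarrow> 'a rel) \<Rightarrow> (nat \<Rightarrow> 'a) rel" where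
  "NP u v X \<kappa> =
     {(x, x'). x \<in> Pi\<^sub>E {1..v} X \<and> x' \<in> Pi\<^sub>E {1..v} X \<and>
        1 \<le> card {i \<in> {1..v}. (x i, x' i) \<in> \<kappa> i} \<and>
        card {i \<in> {1..v}. (x i, x' i) \<in> \<kappa> i} \<le> u \<and>
        (\<forall>i \<in> {1..v}. (x i, x' i) \<notin> \<kappa> i \<longrightarrow> x i = x' i)}"

end

theory Submission
  imports Defs
begin

text \<open>Continuity, defined through connected sets, follows from the pointwise criterion that
  adjacent points have equal or adjacent images (\<open>dig_continuousI\<close>). A projection meets
  it at once: a step in the product either moves the chosen coordinate along its own adjacency or
  leaves it fixed.\<close>

text \<open>Neighbours that survive the collapsing of runs are distinct and were already neighbours
  in \<open>xs\<close>, so the equality alternative drops out.\<close>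

lemma successively_remdups_adj_reflcl:
  assumes "successively (\<lambda>a b. a = b \<or> P a b) xs"
  shows "successively P (remdups_adj xs)"
  using assms
  by (induction xs rule: remdups_adj.induct) (auto simp: successively_Cons)

lemma dig_continuousI:
  assumes "f \<in> X \<rightarrow> Y"
    and adj: "\<And>x x'. (x, x') \<in> \<kappa> \<Longrightarrow> f x = f x' \<or> (f x, f x') \<in> \<mu>"
  shows "dig_continuous X \<kappa> Y \<mu> f"
  unfolding dig_continuous_def
proof (intro conjI allI impI)
  fix A assume A: "A \<subseteq> X \<and> dig_connected \<kappa> A"
  show "dig_connected \<mu> (f ` A)"
    unfolding dig_connected_def
  proof (intro ballI)
    fix y y' assume "y \<in> f ` A" "y' \<in> f ` A"
    then obtain x x' where x: "x \<in> A" "y = f x" "x' \<in> A" "y' = f x'"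
      by blast
    then obtain p where p: "p \<noteq> []" "hd p = x" "last p = x'" "set p \<subseteq> A"
        "successively (\<lambda>a b. (a, b) \<in> \<kappa>) p"
      using A unfolding dig_connected_def by meson
    \<comment> \<open>The image of a path may pause where \<open>f\<close> identifies consecutive
      points, whereas \<open>dig_connected\<close> asks for a genuine adjacency at each
      step.\<close>
    have "successively (\<lambda>a b. a = b \<or> (a, b) \<in> \<mu>) (map f p)"
      unfolding successively_map using p(5) by (rule successively_mono) (use adj in auto)
    then have "successively (\<lambda>a b. (a, b) \<in> \<mu>) (remdups_adj (map f p))"
      by (rule successively_remdups_adj_reflcl)
    then show "\<exists>q. q \<noteq> [] \<and> hd q = y \<and> last q = y' \<and> set q \<subseteq> f ` A \<and>
        successively (\<lambda>a b. (a, b) \<in> \<mu>) q"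
      \<comment> \<open>Removing the pauses keeps both endpoints and the set of visited
        points.\<close>
      using p x by (intro exI[of _ "remdups_adj (map f p)"]) (auto simp: hd_map last_map)
  qed
qed (fact assms(1))

theorem theorem4p3:
  fixes u v :: nat
    and X :: "nat \<Rightarrow> int list set"
    and \<kappa> :: "nat \<Rightarrow> int list rel"
  assumes "1 \<le> u" and "u \<le> v"
    and "\<And>j. j \<in> {1..v} \<Longrightarrow> digital_image (X j) (\<kappa> j)"
  shows "\<forall>i \<in> {1..v}. dig_continuous (Pi\<^sub>E {1..v} X) (NP u v X \<kappa>) (X i) (\<kappa> i) (\<lambda>x. x i)"
  \<comment> \<open>The last conjunct of \<open>NP\<close>, taken at the index \<open>i\<close>, is
    exactly the required alternative.\<close>
  by (intro ballI dig_continuousI) (auto simp: NP_def)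

end
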